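(* Let $\Gamma=a_1\Gamma_1+a_2\mathbb{N}$ be a gluing of numerical semigroups, and let $z$ be an integer. Express $z$ as $z=a_1\alpha+a_2\beta$ with $0\leq \beta<a_1$ and $\alpha,\beta\in\mathbb{Z}$. Then: (1) $\operatorname{Ap}(\Gamma,z)=\big(a_1\operatorname{Ap}(\Gamma_1,\alpha+a_2)+a_2\{0,\ldots,\beta-1\}\big)\cup\big(a_1\operatorname{Ap}(\Gamma_1,\alpha)+a_2\{\beta,\ldots,a_1-1\}\big)$; (2) $\mathrm D_\Gamma(z)=\big(a_1\mathrm D_{\Gamma_1}(\alpha)+a_2\{0,\ldots,\beta\}\big)\cup \big(a_1\mathrm D_{\Gamma_1}(\alpha-a_2)+a_2\{\beta+1,\ldots,a_1-1\}\big)$; (3) $\#\operatorname{Ap}(\Gamma,z)=\beta\cdot\#\operatorname{Ap}(\Gamma_1,\alpha+a_2)+(a_1-\beta)\cdot\#\operatorname{Ap}(\Gamma_1,\alpha)$; (4) $\#\mathrm D_\Gamma(z)=(\beta+1)\cdot\#\mathrm D_{\Gamma_1}(\alpha)+(a_1-\beta-1)\cdot\#\mathrm D_{\Gamma_1}(\alpha-a_2)$.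
   Context: $\mathbb N$ denotes the non-negative integers. A numerical semigroup is a set $\langle n_1,\dots,n_m\rangle:=n_1\mathbb N+\cdots+n_m\mathbb N$ with $n_i$ positive integers and $\gcd(n_1,\dots,n_m)=1$. The minimal generators of $\Gamma$ are the elements of its unique minimal generating set. For $x\in\mathbb Z$, the Apéry set is $\operatorname{Ap}(\Gamma,x)=\{a\in\Gamma\mid a-x\notin\Gamma\}$, and the set of divisors is $\mathrm D_\Gamma(x)=\{c\in\Gamma\mid x-c\in\Gamma\}$. Gluing: given numerical semigroups $\Gamma_1,\Gamma_2$, $a_1\in\Gamma_2$ and $a_2\in\Gamma_1$ with $\gcd(a_1,a_2)=1$, $a_1$ not a minimal generator of $\Gamma_2$ and $a_2$ not a minimal generator of $\Gamma_1$, the numerical semigroup $a_1\Gamma_1+a_2\Gamma_2$ is called a gluing of $\Gamma_1$ and $\Gamma_2$. Here $\Gamma_2=\mathbb N$. For sets of integers $X,Y$ and an integer $a$: $aX=\{ax\mid x\in X\}$ and $X+Y=\{x+y\mid x\in X,y\in Y\}$ (empty if either is empty); $\{u,\dots,v\}$ is empty if $u>v$. *)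

theory Defs
  imports Complex_Main "HOL-Library.Set_Algebras"
begin

text \<open>
  Semigroups are sets of integers, so that differences are never truncated.
  The dilation \<open>aX\<close> is \<open>a *o X\<close> and the sum of two sets is \<open>X + Y\<close>, both from
  \<open>HOL-Library.Set_Algebras\<close>.
\<close>

definition generated :: "int set \<Rightarrow> int set" where
  "generated A = {\<Sum>n\<in>F. int (c n) * n | F c. finite F \<and> F \<subseteq> A}"

text \<open>\<open>Gcd {} = 0\<close>, so \<open>A\<close> is nonempty below.\<close>

definition numerical_semigroup :: "int set \<Rightarrow> bool" where
  "numerical_semigroup S \<longleftrightarrow>
     (\<exists>A. finite A \<and> (\<forall>n\<in>A. n > 0) \<and> Gcd A = 1 \<and> S = generated A)"

definition minimal_generating_set :: "int set \<Rightarrow> int set \<Rightarrow> bool" where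
  "minimal_generating_set A S \<longleftrightarrow>
     generated A = S \<and> (\<forall>B. B \<subset> A \<longrightarrow> generated B \<noteq> S)"

text \<open>For a numerical semigroup the description is proper, see
  \<open>ex1_minimal_generating_set\<close> below.\<close>

definition minimal_generators :: "int set \<Rightarrow> int set" where
  "minimal_generators S = (THE A. minimal_generating_set A S)"

definition Ap :: "int set \<Rightarrow> int \<Rightarrow> int set" where
  "Ap S x = {a \<in> S. a - x \<notin> S}"

definition divisors :: "int set \<Rightarrow> int \<Rightarrow> int set" where
  "divisors S x = {c \<in> S. x - c \<in> S}"

definition gluing :: "int set \<Rightarrow> int \<Rightarrow> int set \<Rightarrow> int \<Rightarrow> int set \<Rightarrow> bool" where
  "gluing S a1 S1 a2 S2 \<longleftrightarrow>
     numerical_semigroup S1 \<and> numerical_semigroup S2 \<and>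
     a1 \<in> S2 \<and> a2 \<in> S1 \<and> gcd a1 a2 = 1 \<and>
     a1 \<notin> minimal_generators S2 \<and> a2 \<notin> minimal_generators S1 \<and>
     S = a1 *o S1 + a2 *o S2"

lemma generated_0: "0 \<in> generated A"
  unfolding generated_def by (force intro: exI[of _ "{}"])

lemma generated_base: "a \<in> A \<Longrightarrow> a \<in> generated A"
  unfolding generated_def by (force intro: exI[of _ "{a}"] exI[of _ "\<lambda>_. 1"])

lemma generated_add:
  assumes "x \<in> generated A" "y \<in> generated A"
  shows "x + y \<in> generated A"
proof -
  obtain F c where F: "finite F" "F \<subseteq> A" "x = (\<Sum>n\<in>F. int (c n) * n)"
    using assms(1) unfolding generated_def by blast
  obtain G d where G: "finite G" "G \<subseteq> A" "y = (\<Sum>n\<in>G. int (d n) * n)"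
    using assms(2) unfolding generated_def by blast
  define e where "e n = (if n \<in> F then c n else 0) + (if n \<in> G then d n else 0)" for n
  have "x = (\<Sum>n\<in>F \<union> G. if n \<in> F then int (c n) * n else 0)"
    unfolding F(3) using F(1) G(1) by (intro sum.mono_neutral_cong_left) auto
  moreover have "y = (\<Sum>n\<in>F \<union> G. if n \<in> G then int (d n) * n else 0)"
    unfolding G(3) using F(1) G(1) by (intro sum.mono_neutral_cong_left) auto
  ultimately have "x + y = (\<Sum>n\<in>F \<union> G. int (e n) * n)"
    by (simp add: sum.distrib[symmetric] e_def) (intro sum.cong, auto simp: algebra_simps)
  then show ?thesis
    unfolding generated_def using F G by blast
qed

lemma generated_least:
  assumes "A \<subseteq> S" "0 \<in> S" "\<And>x y. x \<in> S \<Longrightarrow> y \<in> S \<Longrightarrow> x + y \<in> S"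
  shows "generated A \<subseteq> S"
proof
  fix x assume "x \<in> generated A"
  then obtain F c where F: "finite F" "F \<subseteq> A" "x = (\<Sum>n\<in>F. int (c n) * n)"
    unfolding generated_def by blast
  have mult: "int k * n \<in> S" if "n \<in> S" for k n
    by (induction k) (use that assms in \<open>auto simp: algebra_simps\<close>)
  from F(1,2) have "(\<Sum>n\<in>F. int (c n) * n) \<in> S"
    by (induction F rule: finite_induct) (use assms mult in auto)
  with F(3) show "x \<in> S" by simp
qed

lemma numerical_semigroup_Nats: "numerical_semigroup \<nat>"
proof -
  have "x \<in> generated {1}" if "x \<in> \<nat>" for x
    using that
  proof (induction rule: Nats_induct)
    case (of_nat n)
    show ?case
      by (induction n) (auto simp: generated_0 add.commute intro: generated_add generated_base)
  qed
  moreover have "generated {1} \<subseteq> \<nat>"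
    by (rule generated_least) auto
  ultimately have "generated {1} = \<nat>" by blast
  then show ?thesis
    unfolding numerical_semigroup_def by (intro exI[of _ "{1}"]) simp
qed

lemma ex1_minimal_generating_set:
  assumes "numerical_semigroup S"
  shows "\<exists>!A. minimal_generating_set A S"
proof -
  obtain A0 where A0: "\<forall>n\<in>A0. n > 0" "S = generated A0"
    using assms unfolding numerical_semigroup_def by blast
  have nonneg: "x \<ge> 0" if "x \<in> S" for x
    using generated_least[of A0 "{0..}"] that A0 by force
  define I where "I = {x \<in> S. x \<noteq> 0 \<and> (\<forall>y\<in>S. \<forall>z\<in>S. x = y + z \<longrightarrow> y = 0 \<or> z = 0)}"
  have gen_I: "generated I = S"
  proof
    show "generated I \<subseteq> S"
      using A0(2) generated_0 generated_add by (intro generated_least) (auto simp: I_def)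
    have "x \<in> S \<longrightarrow> x \<in> generated I" for x
    proof (induction "nat x" arbitrary: x rule: less_induct)
      case less
      show ?case
      proof
        assume x: "x \<in> S"
        show "x \<in> generated I"
        proof (cases "x = 0 \<or> x \<in> I")
          case True
          then show ?thesis using generated_0 generated_base by blast
        next
          case False
          then obtain y z where yz: "y \<in> S" "z \<in> S" "x = y + z" "y \<noteq> 0" "z \<noteq> 0"
            using x unfolding I_def by blast
          then have "nat y < nat x" "nat z < nat x"
            using nonneg[of y] nonneg[of z] by auto
          then show ?thesis
            using less yz generated_add by blast
        qed
      qed
    qed
    then show "S \<subseteq> generated I" by blast
  qed
  have I_sub: "I \<subseteq> A" if A: "generated A = S" for A
  proof
    fix x assume x: "x \<in> I"
    \<comment> \<open>an irreducible element outside \<open>A\<close> would leave \<open>S - {x}\<close> a submonoid containing \<open>A\<close>\<close>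
    show "x \<in> A"
    proof (rule ccontr)
      assume "x \<notin> A"
      have "generated A \<subseteq> S - {x}"
      proof (rule generated_least)
        show "A \<subseteq> S - {x}" using A generated_base \<open>x \<notin> A\<close> by blast
        show "0 \<in> S - {x}" using A generated_0 x unfolding I_def by blast
        fix y z assume "y \<in> S - {x}" "z \<in> S - {x}"
        then show "y + z \<in> S - {x}"
          using A generated_add x unfolding I_def by fastforce
      qed
      then show False using x A unfolding I_def by blast
    qed
  qed
  have "minimal_generating_set A S \<longleftrightarrow> A = I" for A
    unfolding minimal_generating_set_def using gen_I I_sub by blast
  then show ?thesis by simp
qed

end

theory Submission
  imports Defs
begin

text \<open>
  Every integer is \<open>a\<^sub>1 u + a\<^sub>2 v\<close> for a unique \<open>u\<close> and a unique \<open>0 \<le> v < a\<^sub>1\<close>, and it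
  lies in \<open>\<Gamma>\<close> iff \<open>u\<close> lies in \<open>\<Gamma>\<^sub>1\<close>. Subtracting \<open>z\<close> subtracts \<open>\<beta>\<close> from the second
  coordinate; when this becomes negative, \<open>a\<^sub>1\<close> is added to it and \<open>a\<^sub>2\<close> is subtracted from
  the first coordinate, which yields the two parts of each union. The parts are injective
  images of disjoint products, so their cardinalities add up once they are finite.
\<close>

section \<open>Numerical semigroups are submonoids of the non-negative integers with finite
  complement\<close>

lemma numerical_semigroup_0: "numerical_semigroup S \<Longrightarrow> 0 \<in> S"
  unfolding numerical_semigroup_def using generated_0 by blast

lemma numerical_semigroup_add:
  "numerical_semigroup S \<Longrightarrow> x \<in> S \<Longrightarrow> y \<in> S \<Longrightarrow> x + y \<in> S"
  unfolding numerical_semigroup_def using generated_add by blast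

lemma numerical_semigroup_nonneg:
  assumes "numerical_semigroup S" "x \<in> S"
  shows "x \<ge> 0"
proof -
  obtain A where "\<forall>n\<in>A. n > 0" "S = generated A"
    using assms(1) unfolding numerical_semigroup_def by blast
  then show ?thesis
    using generated_least[of A "{0..}"] assms(2) by force
qed

lemma numerical_semigroup_mult:
  assumes "numerical_semigroup S" "x \<in> S" "k \<ge> 0"
  shows "k * x \<in> S"
proof -
  have "int n * x \<in> S" for n
    by (induction n)
      (auto simp: algebra_simps assms numerical_semigroup_0 numerical_semigroup_add)
  from this[of "nat k"] show ?thesis using assms(3) by simp
qed

text \<open>A set closed under differences and containing 0 is an ideal of the integers. It
  therefore absorbs the Bezout combination that produces the gcd each time one more element of
  \<open>A\<close> is taken in; \<open>Gcd {} = 0\<close> starts the induction.\<close>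

lemma subgroup_int_Gcd:
  fixes D :: "int set"
  assumes "finite A" "A \<subseteq> D" "0 \<in> D" and diff: "\<And>x y. x \<in> D \<Longrightarrow> y \<in> D \<Longrightarrow> x - y \<in> D"
  shows "Gcd A \<in> D"
proof -
  have minus: "- x \<in> D" if "x \<in> D" for x
    using diff[OF \<open>0 \<in> D\<close> that] by simp
  have add: "x + y \<in> D" if "x \<in> D" "y \<in> D" for x y
    using diff[OF that(1) minus[OF that(2)]] by simp
  \<comment> \<open>The induction runs from 0 in both directions: \<open>add\<close> serves the
    positive multiples, \<open>diff\<close> the negative ones.\<close>
  have mult: "k * x \<in> D" if "x \<in> D" for k x
    by (induction k rule: int_induct[where k = 0])
      (use that \<open>0 \<in> D\<close> add diff in \<open>auto simp: algebra_simps\<close>)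
  from assms(1,2) show ?thesis
  proof (induction A rule: finite_induct)
    case (insert a F)
    obtain u v where "u * a + v * Gcd F = gcd a (Gcd F)"
      using bezout_int by blast
    then have "Gcd (insert a F) = u * a + v * Gcd F" by simp
    then show ?case using insert add mult by simp
  qed (use \<open>0 \<in> D\<close> in simp)
qed

text \<open>The differences of elements of \<open>S\<close> form a group that contains the
  generators, hence their gcd 1. Writing 1 as a difference gives two neighbours.\<close>

lemma numerical_semigroup_consecutive:
  assumes "numerical_semigroup S"
  obtains x where "x \<in> S" "x + 1 \<in> S"
proof -
  obtain A where A: "finite A" "Gcd A = 1" "S = generated A"
    using assms unfolding numerical_semigroup_def by blast
  note S0 = numerical_semigroup_0[OF assms] and Sadd = numerical_semigroup_add[OF assms]
  define D where "D = {x - y | x y. x \<in> S \<and> y \<in> S}"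
  have "Gcd A \<in> D"
  proof (rule subgroup_int_Gcd[OF A(1)])
    show "A \<subseteq> D"
    proof
      fix n assume "n \<in> A"
      then have "n \<in> S" using generated_base A(3) by simp
      moreover have "n = n - 0" by simp
      ultimately show "n \<in> D" using S0 unfolding D_def by blast
    qed
    show "0 \<in> D" using S0 unfolding D_def by force
    fix p q assume "p \<in> D" "q \<in> D"
    then obtain x y x' y' where
      xy: "p = x - y" "q = x' - y'" "x \<in> S" "y \<in> S" "x' \<in> S" "y' \<in> S"
      unfolding D_def by blast
    then have "p - q = (x + y') - (y + x')" by simp
    then show "p - q \<in> D" using xy Sadd unfolding D_def by blast
  qed
  then obtain x y where "1 = x - y" "x \<in> S" "y \<in> S"
    using A(2) unfolding D_def by auto
  then show thesis using that[of y] by (simp add: algebra_simps)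
qed

text \<open>With \<open>x\<close> and \<open>x + 1\<close> available, a remainder \<open>r\<close>
  modulo \<open>x\<close> is produced by replacing \<open>r\<close> of the \<open>q\<close> summands
  \<open>x\<close> by \<open>x + 1\<close>. This needs \<open>r \<le> q\<close>, which the bound
  \<open>x * x\<close> guarantees through \<open>r < x \<le> q\<close>.\<close>

lemma numerical_semigroup_cofinal:
  assumes "numerical_semigroup S"
  obtains c where "\<And>n. n \<ge> c \<Longrightarrow> n \<in> S"
proof -
  obtain x where x: "x \<in> S" "x + 1 \<in> S"
    using numerical_semigroup_consecutive[OF assms] .
  have "x \<ge> 0" using numerical_semigroup_nonneg[OF assms x(1)] .
  have "n \<in> S" if n: "n \<ge> x * x" for n
  proof (cases "x = 0")
    \<comment> \<open>Division by \<open>x\<close> says nothing here, but now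
      \<open>x + 1 = 1\<close> lies in \<open>S\<close>.\<close>
    case True
    then show ?thesis using numerical_semigroup_mult[OF assms x(2), of n] n by simp
  next
    case False
    define q r where "q = n div x" and "r = n mod x"
    have r: "0 \<le> r" "r < x" using False \<open>x \<ge> 0\<close> by (auto simp: r_def)
    have "x \<le> q"
      using n False \<open>x \<ge> 0\<close> zdiv_mono1[of "x * x" n x] by (simp add: q_def)
    have "n = q * x + r" by (simp add: q_def r_def)
    then have "n = (q - r) * x + r * (x + 1)" by (simp add: algebra_simps)
    moreover have "(q - r) * x \<in> S" "r * (x + 1) \<in> S"
      using r \<open>x \<le> q\<close> x numerical_semigroup_mult[OF assms] by auto
    ultimately show ?thesis using numerical_semigroup_add[OF assms] by simp
  qed
  then show thesis using that by blast
qed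

text \<open>Once \<open>a - x\<close> reaches the point beyond which everything lies in
  \<open>S\<close>, \<open>a\<close> is excluded; elements of \<open>S\<close> are bounded below by
  0.\<close>

lemma finite_Ap:
  assumes "numerical_semigroup S"
  shows "finite (Ap S x)"
proof -
  obtain c where c: "\<And>n. n \<ge> c \<Longrightarrow> n \<in> S"
    using numerical_semigroup_cofinal[OF assms] by blast
  have "Ap S x \<subseteq> {0..c + x}"
    using c[of "a - x" for a] numerical_semigroup_nonneg[OF assms] unfolding Ap_def by force
  then show ?thesis by (rule finite_subset) simp
qed

lemma finite_divisors:
  assumes "numerical_semigroup S"
  shows "finite (divisors S x)"
proof -
  have "divisors S x \<subseteq> {0..x}"
    using numerical_semigroup_nonneg[OF assms] unfolding divisors_def by force
  then show ?thesis by (rule finite_subset) simp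
qed

section \<open>Coordinates of the integers with respect to two coprime numbers\<close>

lemma mem_elt_set_times_plus_iff:
  fixes a b :: int
  shows "n \<in> a *o X + b *o Y \<longleftrightarrow> (\<exists>u\<in>X. \<exists>v\<in>Y. n = a * u + b * v)"
  unfolding elt_set_times_def set_plus_def by blast

lemma elt_set_times_plus_eq:
  fixes a b :: int
  shows "a *o X + b *o Y = (\<lambda>(u, v). a * u + b * v) ` (X \<times> Y)"
  by (simp add: set_eq_iff mem_elt_set_times_plus_iff image_iff)

text \<open>If two pairs have the same value, \<open>a\<close> divides \<open>b * (v - v')\<close>,
  hence \<open>v - v'\<close> by coprimality, and two elements of \<open>{0..<a}\<close> that are
  congruent modulo \<open>a\<close> coincide.\<close>

lemma coprime_combination_inj:
  fixes a b :: int
  assumes "gcd a b = 1" "a > 0"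
  shows "inj_on (\<lambda>(u, v). a * u + b * v) (UNIV \<times> {0..<a})"
proof (rule inj_onI, clarsimp)
  fix u v u' v'
  assume v: "0 \<le> v" "v < a" "0 \<le> v'" "v' < a" and eq: "a * u + b * v = a * u' + b * v'"
  from eq have "b * (v - v') = a * (u' - u)" by (simp add: algebra_simps)
  then have "a dvd b * (v - v')" by simp
  then have "a dvd v - v'"
    using assms(1) by (simp add: coprime_dvd_mult_right_iff coprime_iff_gcd_eq_1)
  \<comment> \<open>A divisor bounds only positive multiples of itself, so both signs of the
    difference are considered.\<close>
  then have "v = v'"
    using v zdvd_imp_le[of a "v - v'"] zdvd_imp_le[of a "v' - v"]
    by (cases v v' rule: linorder_cases) (auto simp: dvd_diff_commute)
  then show "u = u' \<and> v = v'" using eq assms(2) by simp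
qed

text \<open>A Bezout identity multiplied by \<open>n\<close> gives some pair. Reducing its second
  entry modulo \<open>a\<close> and carrying the quotient, times \<open>b\<close>, to the first
  entry brings it into range.\<close>

lemma coprime_combination_surj:
  fixes a b n :: int
  assumes "gcd a b = 1" "a > 0"
  obtains u v where "n = a * u + b * v" "0 \<le> v" "v < a"
proof -
  obtain p q where "p * a + q * b = 1"
    using bezout_int[of a b] assms(1) by auto
  then have "n = n * (p * a + q * b)" by simp
  also have "\<dots> = a * (n * p) + b * (n * q)" by (simp add: algebra_simps)
  also have "\<dots> = a * (n * p) + b * (a * (n * q div a) + n * q mod a)" by simp
  also have "\<dots> = a * (n * p + b * (n * q div a)) + b * (n * q mod a)"
    by (simp only: algebra_simps)
  finally show thesis using assms(2) that by simp
qed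

text \<open>A representation in the gluing may have a second entry \<open>k \<ge> a\<close>.
  Reducing it modulo \<open>a\<close> adds \<open>k div a * b\<close> to the first entry, which
  stays in \<open>S1\<close> because \<open>b \<in> S1\<close> and \<open>k div a \<ge> 0\<close>.
  Uniqueness of coordinates then identifies the result with \<open>u\<close>.\<close>

lemma mem_gluing_iff:
  assumes G: "gluing S a S1 b \<nat>" and v: "0 \<le> v" "v < a"
  shows "a * u + b * v \<in> S \<longleftrightarrow> u \<in> S1"
proof -
  have S: "S = a *o S1 + b *o \<nat>" and S1: "numerical_semigroup S1"
    and b: "b \<in> S1" and gcd: "gcd a b = 1"
    using G unfolding gluing_def by auto
  have "a > 0" using v by simp
  show ?thesis
  proof
    assume "u \<in> S1"
    moreover have "v \<in> \<nat>" using v by (simp add: Nats_altdef1)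
    ultimately show "a * u + b * v \<in> S" unfolding S mem_elt_set_times_plus_iff by blast
  next
    assume "a * u + b * v \<in> S"
    then obtain s k where k: "s \<in> S1" "k \<in> \<nat>" "a * u + b * v = a * s + b * k"
      unfolding S mem_elt_set_times_plus_iff by blast
    have "k \<ge> 0" using k(2) by (auto simp: Nats_altdef1)
    have "b * k = b * (a * (k div a) + k mod a)" by simp
    then have "a * u + b * v = a * (s + k div a * b) + b * (k mod a)"
      using k(3) by (simp only: algebra_simps)
    then have "u = s + k div a * b"
      using inj_onD[OF coprime_combination_inj[OF gcd \<open>a > 0\<close>],
          of "(u, v)" "(s + k div a * b, k mod a)"] v \<open>a > 0\<close> by simp
    moreover have "k div a * b \<in> S1"
      using \<open>k \<ge> 0\<close> \<open>a > 0\<close> by (intro numerical_semigroup_mult[OF S1 b])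
        (simp add: pos_imp_zdiv_nonneg_iff)
    ultimately show "u \<in> S1" using k(1) numerical_semigroup_add[OF S1] by simp
  qed
qed

text \<open>Reduces an equality of sets to a membership test in coordinates: every integer has
  coordinates in range, and \<open>I\<close> and \<open>J\<close> admit no others.\<close>

lemma coprime_combination_set_eqI:
  fixes a b :: int
  assumes ab: "gcd a b = 1" "a > 0" and IJ: "I \<subseteq> {0..<a}" "J \<subseteq> {0..<a}"
    and mem: "\<And>u v. 0 \<le> v \<Longrightarrow> v < a \<Longrightarrow>
      a * u + b * v \<in> T \<longleftrightarrow> u \<in> X \<and> v \<in> I \<or> u \<in> Y \<and> v \<in> J"
  shows "T = (a *o X + b *o I) \<union> (a *o Y + b *o J)"
proof
  show "T \<subseteq> (a *o X + b *o I) \<union> (a *o Y + b *o J)"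
  proof
    fix n assume "n \<in> T"
    obtain u v where uv: "n = a * u + b * v" "0 \<le> v" "v < a"
      using coprime_combination_surj[OF ab] .
    then have "u \<in> X \<and> v \<in> I \<or> u \<in> Y \<and> v \<in> J" using \<open>n \<in> T\<close> mem by blast
    then show "n \<in> (a *o X + b *o I) \<union> (a *o Y + b *o J)"
      unfolding Un_iff mem_elt_set_times_plus_iff uv(1) by blast
  qed
  show "(a *o X + b *o I) \<union> (a *o Y + b *o J) \<subseteq> T"
  proof
    fix n assume "n \<in> (a *o X + b *o I) \<union> (a *o Y + b *o J)"
    then obtain u v where "n = a * u + b * v" "u \<in> X \<and> v \<in> I \<or> u \<in> Y \<and> v \<in> J"
      unfolding Un_iff mem_elt_set_times_plus_iff by blast
    moreover from this have "0 \<le> v" "v < a" using IJ by auto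
    ultimately show "n \<in> T" using mem by blast
  qed
qed

text \<open>Both products lie where the coordinate map is injective, and
  \<open>I \<inter> J = {}\<close> makes them disjoint even if \<open>X\<close> and \<open>Y\<close>
  overlap. Finiteness matters since \<open>card\<close> is 0 on infinite sets.\<close>

lemma card_coprime_combination:
  fixes a b :: int
  assumes ab: "gcd a b = 1" "a > 0" and IJ: "I \<subseteq> {0..<a}" "J \<subseteq> {0..<a}" "I \<inter> J = {}"
    and fin: "finite X" "finite Y"
  shows "card ((a *o X + b *o I) \<union> (a *o Y + b *o J)) = card I * card X + card J * card Y"
proof -
  let ?f = "\<lambda>(u, v). a * u + b * v"
  have finIJ: "finite I" "finite J" using IJ finite_subset by blast+
  have "card (?f ` (X \<times> I \<union> Y \<times> J)) = card (X \<times> I \<union> Y \<times> J)"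
    using IJ by (intro card_image inj_on_subset[OF coprime_combination_inj[OF ab]]) auto
  also have "\<dots> = card (X \<times> I) + card (Y \<times> J)"
    using fin finIJ IJ(3) by (intro card_Un_disjoint) auto
  finally show ?thesis
    by (simp add: elt_set_times_plus_eq image_Un card_cartesian_product mult.commute)
qed

section \<open>Apery sets and divisor sets of the gluing\<close>

theorem theorem12:
  fixes \<Gamma> \<Gamma>\<^sub>1 :: "int set" and a\<^sub>1 a\<^sub>2 z \<alpha> \<beta> :: int
  assumes "gluing \<Gamma> a\<^sub>1 \<Gamma>\<^sub>1 a\<^sub>2 \<nat>"
    and "z = a\<^sub>1 * \<alpha> + a\<^sub>2 * \<beta>" and "0 \<le> \<beta>" and "\<beta> < a\<^sub>1"
  shows "Ap \<Gamma> z =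
           (a\<^sub>1 *o Ap \<Gamma>\<^sub>1 (\<alpha> + a\<^sub>2) + a\<^sub>2 *o {0..\<beta> - 1}) \<union>
           (a\<^sub>1 *o Ap \<Gamma>\<^sub>1 \<alpha> + a\<^sub>2 *o {\<beta>..a\<^sub>1 - 1}) \<and>
         divisors \<Gamma> z =
           (a\<^sub>1 *o divisors \<Gamma>\<^sub>1 \<alpha> + a\<^sub>2 *o {0..\<beta>}) \<union>
           (a\<^sub>1 *o divisors \<Gamma>\<^sub>1 (\<alpha> - a\<^sub>2) + a\<^sub>2 *o {\<beta> + 1..a\<^sub>1 - 1}) \<and>
         int (card (Ap \<Gamma> z)) =
           \<beta> * int (card (Ap \<Gamma>\<^sub>1 (\<alpha> + a\<^sub>2))) + (a\<^sub>1 - \<beta>) * int (card (Ap \<Gamma>\<^sub>1 \<alpha>)) \<and>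
         int (card (divisors \<Gamma> z)) =
           (\<beta> + 1) * int (card (divisors \<Gamma>\<^sub>1 \<alpha>)) +
           (a\<^sub>1 - \<beta> - 1) * int (card (divisors \<Gamma>\<^sub>1 (\<alpha> - a\<^sub>2)))"
proof -
  have \<Gamma>\<^sub>1: "numerical_semigroup \<Gamma>\<^sub>1" and gcd: "gcd a\<^sub>1 a\<^sub>2 = 1"
    using assms(1) unfolding gluing_def by auto
  have pos: "a\<^sub>1 > 0" using assms by simp
  note mem = mem_gluing_iff[OF assms(1)]
  have ap: "Ap \<Gamma> z =
           (a\<^sub>1 *o Ap \<Gamma>\<^sub>1 (\<alpha> + a\<^sub>2) + a\<^sub>2 *o {0..\<beta> - 1}) \<union>
           (a\<^sub>1 *o Ap \<Gamma>\<^sub>1 \<alpha> + a\<^sub>2 *o {\<beta>..a\<^sub>1 - 1})"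
  proof (rule coprime_combination_set_eqI[OF gcd pos])
    fix u v assume v: "0 \<le> v" "v < a\<^sub>1"
    \<comment> \<open>The two forms differ by moving \<open>a\<^sub>1 * a\<^sub>2\<close> between
      the summands. In each case below the form is used whose second coordinate lies in
      \<open>{0..<a\<^sub>1}\<close>, so that \<open>mem\<close> applies.\<close>
    have ge: "a\<^sub>1 * u + a\<^sub>2 * v - z = a\<^sub>1 * (u - \<alpha>) + a\<^sub>2 * (v - \<beta>)"
      and less: "a\<^sub>1 * u + a\<^sub>2 * v - z = a\<^sub>1 * (u - (\<alpha> + a\<^sub>2)) + a\<^sub>2 * (v - \<beta> + a\<^sub>1)"
      using assms(2) by (simp_all add: algebra_simps)
    show "a\<^sub>1 * u + a\<^sub>2 * v \<in> Ap \<Gamma> z \<longleftrightarrow>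
      u \<in> Ap \<Gamma>\<^sub>1 (\<alpha> + a\<^sub>2) \<and> v \<in> {0..\<beta> - 1} \<or> u \<in> Ap \<Gamma>\<^sub>1 \<alpha> \<and> v \<in> {\<beta>..a\<^sub>1 - 1}"
    proof (cases "v < \<beta>")
      case True
      then have "a\<^sub>1 * u + a\<^sub>2 * v - z \<in> \<Gamma> \<longleftrightarrow> u - (\<alpha> + a\<^sub>2) \<in> \<Gamma>\<^sub>1"
        unfolding less using v assms(3,4) by (intro mem) auto
      then show ?thesis using True v mem[OF v] by (auto simp: Ap_def)
    next
      case False
      then have "a\<^sub>1 * u + a\<^sub>2 * v - z \<in> \<Gamma> \<longleftrightarrow> u - \<alpha> \<in> \<Gamma>\<^sub>1"
        unfolding ge using v assms(3,4) by (intro mem) auto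
      then show ?thesis using False v mem[OF v] by (auto simp: Ap_def)
    qed
  qed (use assms(3,4) in auto)
  have div: "divisors \<Gamma> z =
           (a\<^sub>1 *o divisors \<Gamma>\<^sub>1 \<alpha> + a\<^sub>2 *o {0..\<beta>}) \<union>
           (a\<^sub>1 *o divisors \<Gamma>\<^sub>1 (\<alpha> - a\<^sub>2) + a\<^sub>2 *o {\<beta> + 1..a\<^sub>1 - 1})"
  proof (rule coprime_combination_set_eqI[OF gcd pos])
    fix u v assume v: "0 \<le> v" "v < a\<^sub>1"
    \<comment> \<open>Subtraction from \<open>z\<close> reverses the signs: the second coordinate is
      now \<open>\<beta> - v\<close>, so \<open>v = \<beta>\<close> requires no carry and belongs to
      the first part, and the carry replaces \<open>\<alpha>\<close> by
      \<open>\<alpha> - a\<^sub>2\<close>.\<close>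
    have le: "z - (a\<^sub>1 * u + a\<^sub>2 * v) = a\<^sub>1 * (\<alpha> - u) + a\<^sub>2 * (\<beta> - v)"
      and greater: "z - (a\<^sub>1 * u + a\<^sub>2 * v) = a\<^sub>1 * (\<alpha> - a\<^sub>2 - u) + a\<^sub>2 * (\<beta> - v + a\<^sub>1)"
      using assms(2) by (simp_all add: algebra_simps)
    show "a\<^sub>1 * u + a\<^sub>2 * v \<in> divisors \<Gamma> z \<longleftrightarrow>
      u \<in> divisors \<Gamma>\<^sub>1 \<alpha> \<and> v \<in> {0..\<beta>} \<or>
      u \<in> divisors \<Gamma>\<^sub>1 (\<alpha> - a\<^sub>2) \<and> v \<in> {\<beta> + 1..a\<^sub>1 - 1}"
    proof (cases "v \<le> \<beta>")
      case True
      then have "z - (a\<^sub>1 * u + a\<^sub>2 * v) \<in> \<Gamma> \<longleftrightarrow> \<alpha> - u \<in> \<Gamma>\<^sub>1"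
        unfolding le using v assms(3,4) by (intro mem) auto
      then show ?thesis using True v mem[OF v] by (auto simp: divisors_def)
    next
      case False
      then have "z - (a\<^sub>1 * u + a\<^sub>2 * v) \<in> \<Gamma> \<longleftrightarrow> \<alpha> - a\<^sub>2 - u \<in> \<Gamma>\<^sub>1"
        unfolding greater using v assms(3,4) by (intro mem) auto
      then show ?thesis using False v mem[OF v] by (auto simp: divisors_def)
    qed
  qed (use assms(3,4) in auto)
  \<comment> \<open>The intervals have \<open>\<beta>\<close> and \<open>a\<^sub>1 - \<beta>\<close>
    elements. Both numbers are non-negative, so the conversion through \<open>nat\<close> is exact,
    also for \<open>\<beta> = 0\<close>, where the first interval is empty.\<close>
  have "int (card (Ap \<Gamma> z)) =
      \<beta> * int (card (Ap \<Gamma>\<^sub>1 (\<alpha> + a\<^sub>2))) + (a\<^sub>1 - \<beta>) * int (card (Ap \<Gamma>\<^sub>1 \<alpha>))"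
    unfolding ap using assms(3,4)
    by (subst card_coprime_combination[OF gcd pos _ _ _ finite_Ap[OF \<Gamma>\<^sub>1] finite_Ap[OF \<Gamma>\<^sub>1]])
      auto
  \<comment> \<open>Here the interval lengths are \<open>\<beta> + 1\<close> and
    \<open>a\<^sub>1 - \<beta> - 1\<close>; the latter is non-negative because
    \<open>\<beta> < a\<^sub>1\<close>.\<close>
  moreover have "int (card (divisors \<Gamma> z)) =
      (\<beta> + 1) * int (card (divisors \<Gamma>\<^sub>1 \<alpha>)) +
      (a\<^sub>1 - \<beta> - 1) * int (card (divisors \<Gamma>\<^sub>1 (\<alpha> - a\<^sub>2)))"
    unfolding div using assms(3,4)
    by (subst card_coprime_combination[OF gcd pos _ _ _
          finite_divisors[OF \<Gamma>\<^sub>1] finite_divisors[OF \<Gamma>\<^sub>1]])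
      auto
  ultimately show ?thesis using ap div by blast
qed

end
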